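(* Assume that the fluxes are linear, $\widehat{\mathbf F}_{i+\frac12,j}=\sum_{l=-r_0}^{s_0}\alpha_l\mathbf F_{i+l,j}$ and $\widehat{\mathbf F}_{i,j+\frac12}=\sum_{l=-r_0'}^{s_0'}\alpha'_l\mathbf F_{i,j+l}$ with constant real coefficients, and that there exist $\gamma,\gamma'>0$ such that, for all $\varepsilon>0$ under consideration, $\mathrm{Id}_{M\times M}+\frac{\Delta t}{\varepsilon}W$ is invertible and $$\Big\Vert \big(\mathrm{Id}_{M\times M}+\tfrac{\Delta t}{\varepsilon}W\big)^{-1}\Big\Vert\le\gamma,\qquad \frac{\Delta t}{\varepsilon}\Big\Vert\big(\mathrm{Id}_{M\times M}+\tfrac{\Delta t}{\varepsilon}W\big)^{-1}W\Big\Vert\le\gamma'.$$ Let $\mathbf F^{*}$ be the unique solution of $L_2(\mathbf F)=0$, and let $(\mathbf F^{(r)})_{r\ge0}$ be the defect correction iterates defined by $\mathbf F^{(0)}=(\mathbf f^n,\dots,\mathbf f^n)^T$ and $L_1(\mathbf F^{(r+1)})=L_1(\mathbf F^{(r)})-L_2(\mathbf F^{(r)})$. Then there exists $\theta$ independent of $\varepsilon$ such that, for all $r\ge 0$, $$\Vert\mathbf F^{(r+1)}-\mathbf F^{*}\Vert_{L^2}\le(\theta\Delta t)^{r+1}\Vert\mathbf F^{(0)}-\mathbf F^{*}\Vert_{L^2}.$$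
   Context: Kinetic model. $\mathbf A_1,\mathbf A_2:\mathbb R^K\to\mathbb R^K$ are locally Lipschitz fluxes of the conservation law $\partial_t\mathbf u+\partial_x\mathbf A_1(\mathbf u)+\partial_y\mathbf A_2(\mathbf u)=0$. It is approximated by $\partial_t\mathbf f+\Lambda_x\partial_x\mathbf f+\Lambda_y\partial_y\mathbf f=\frac{1}{\varepsilon}(\mathbb M(\mathbb P\mathbf f)-\mathbf f)$, with $\varepsilon>0$, $\mathbf f$ valued in $\mathbb R^L$, $\Lambda_x,\Lambda_y$ real diagonal $L\times L$ matrices, $\mathbb P$ a real constant $K\times L$ matrix, and $\mathbb M:\mathbb R^K\to\mathbb R^L$ Lipschitz continuous (the Maxwellian) with $\mathbb P\mathbb M(\mathbf u)=\mathbf u$, $\mathbb P\Lambda_x\mathbb M(\mathbf u)=\mathbf A_1(\mathbf u)$, $\mathbb P\Lambda_y\mathbb M(\mathbf u)=\mathbf A_2(\mathbf u)$. Discretisation. The grid is regular Cartesian with points $\mathbf x_l=(x_i,y_j)$, $l=(i,j)\in\mathbb Z^2$, and steps $\Delta x,\Delta y>0$; $\Delta t>0$ is the time step. Let $0=\beta_0<\beta_1<\dots<\beta_M=1$, let $\ell_q$ ($0\le q\le M$) be the Lagrange basis polynomials at these nodes, $w_{pq}=\int_0^{\beta_p}\ell_q(s)\,ds$ (so $\sum_{q=0}^M w_{pq}=\beta_p$), $W=(w_{pq})_{1\le p,q\le M}$, $\mathbf w_0=(w_{10},\dots,w_{M0})^T$, $B=\mathrm{diag}(\beta_1,\dots,\beta_M)$.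 Let $\mathbf f^n=\mathbf f^{n,0}$ be the given grid function at time $t_n$. A vector of sub-step approximations is $\mathbf F=(\mathbf f^{n,1},\dots,\mathbf f^{n,M})^T$, with value $\mathbf F_l\in(\mathbb R^L)^M$ at grid point $l$; $\mathbf F^{(0)}=(\mathbf f^n,\dots,\mathbf f^n)^T$. $W$ and $B$ act on the sub-step index, while $\Lambda_x,\Lambda_y,\mathbb P,\mathbb M$ act on each sub-step separately; $\mathbf w_0\otimes\mathbf g=(w_{10}\mathbf g,\dots,w_{M0}\mathbf g)^T$. The difference operators are $\delta^x_{(i,j)}\mathbf F=\widehat{\mathbf F}_{i+\frac12,j}-\widehat{\mathbf F}_{i-\frac12,j}$ and $\delta^y_{(i,j)}\mathbf F=\widehat{\mathbf F}_{i,j+\frac12}-\widehat{\mathbf F}_{i,j-\frac12}$, with numerical fluxes $\widehat{\mathbf F}$. For each $l$, $$[L_2(\mathbf F)]_l=\mathbf F_l-\mathbf F^{(0)}_l+\tfrac{\Delta t}{\Delta x}\Lambda_xW\delta^x_l\mathbf F+\tfrac{\Delta t}{\Delta x}\Lambda_x\mathbf w_0\otimes\delta^x_l\mathbf f^{n,0}+\tfrac{\Delta t}{\Delta y}\Lambda_yW\delta^y_l\mathbf F+\tfrac{\Delta t}{\Delta y}\Lambda_y\mathbf w_0\otimes\delta^y_l\mathbf f^{n,0}-\tfrac{\Delta t}{\varepsilon}W(\mathbb M(\mathbb P\mathbf F_l)-\mathbf F_l)-\tfrac{\Delta t}{\varepsilon}\mathbf w_0\otimes(\mathbb M(\mathbb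 P\mathbf f^{n,0}_l)-\mathbf f^{n,0}_l),$$ $$[L_1(\mathbf F)]_l=\mathbf F_l-\mathbf F^{(0)}_l+\tfrac{\Delta t}{\Delta x}B\Lambda_x\delta^x_l\mathbf F^{(0)}+\tfrac{\Delta t}{\Delta y}B\Lambda_y\delta^y_l\mathbf F^{(0)}-\tfrac{\Delta t}{\varepsilon}W(\mathbb M(\mathbb P\mathbf F_l)-\mathbf F_l)-\tfrac{\Delta t}{\varepsilon}\mathbf w_0\otimes(\mathbb M(\mathbb P\mathbf f^{n,0}_l)-\mathbf f^{n,0}_l).$$ Norm. For a grid function, $\Vert\varphi\Vert_{L^2}^2=\sum_{i,j\in\mathbb Z}\Delta x\,\Delta y\,\Vert\varphi_{i,j}\Vert^2$. *)

theory Defs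
  imports "HOL-Analysis.Analysis"
begin

text \<open>
  The M sub-steps are indexed by a finite linearly ordered type \<open>'m\<close>, so that \<open>M = CARD('m)\<close> and
  \<open>substep_no\<close> enumerates \<open>'m\<close> increasingly by \<open>1, \<dots>, M\<close>. The nodes
  \<open>\<beta> 0, \<dots>, \<beta> M\<close> are the first values of a sequence; node 0 is not a sub-step.
\<close>

type_synonym 'a grid_fun = "int \<times> int \<Rightarrow> 'a"

definition substep_no :: "'m::{finite,linorder} \<Rightarrow> nat" where
  "substep_no p = card {..p}"

definition lagrange_basis :: "(nat \<Rightarrow> real) \<Rightarrow> nat \<Rightarrow> nat \<Rightarrow> real \<Rightarrow> real" where
  "lagrange_basis \<beta> M q s = (\<Prod>j\<in>{0..M} - {q}. (s - \<beta> j) / (\<beta> q - \<beta> j))"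

definition quad_weight :: "(nat \<Rightarrow> real) \<Rightarrow> nat \<Rightarrow> nat \<Rightarrow> nat \<Rightarrow> real" where
  "quad_weight \<beta> M p q = integral {0..\<beta> p} (lagrange_basis \<beta> M q)"

definition W_mat :: "(nat \<Rightarrow> real) \<Rightarrow> real^('m::{finite,linorder})^('m::{finite,linorder})" where
  "W_mat \<beta> = (\<chi> p q. quad_weight \<beta> CARD('m) (substep_no p) (substep_no q))"

definition w0_vec :: "(nat \<Rightarrow> real) \<Rightarrow> real^('m::{finite,linorder})" where
  "w0_vec \<beta> = (\<chi> p. quad_weight \<beta> CARD('m) (substep_no p) 0)"

definition B_mat :: "(nat \<Rightarrow> real) \<Rightarrow> real^('m::{finite,linorder})^('m::{finite,linorder})" where
  "B_mat \<beta> = (\<chi> p q. if p = q then \<beta> (substep_no p) else 0)"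

text \<open>Action of a matrix on the sub-step index, action of a map on each sub-step, and
  \<open>w \<otimes> g\<close>.\<close>

definition substep_mult :: "real^'m^'m \<Rightarrow> ('a::real_vector)^'m \<Rightarrow> 'a^'m" where
  "substep_mult A V = (\<chi> p. \<Sum>q\<in>UNIV. A $ p $ q *\<^sub>R V $ q)"

definition substep_map :: "('a \<Rightarrow> 'b) \<Rightarrow> 'a^'m \<Rightarrow> 'b^'m" where
  "substep_map h V = (\<chi> p. h (V $ p))"

definition substep_tensor :: "real^'m \<Rightarrow> 'a::real_vector \<Rightarrow> 'a^'m" where
  "substep_tensor w g = (\<chi> p. w $ p *\<^sub>R g)"

definition substep_const :: "'a grid_fun \<Rightarrow> ('a^'m) grid_fun" where
  "substep_const f = (\<lambda>l. \<chi> p. f l)"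

text \<open>The value of a numerical flux at \<open>(i, j)\<close> stands for the one at the right interface
  \<open>(i + 1/2, j)\<close>, respectively at the upper interface \<open>(i, j + 1/2)\<close>; the stencil is
  \<open>l = -r, \<dots>, s\<close>.\<close>

definition flux_x :: "(int \<Rightarrow> real) \<Rightarrow> int \<Rightarrow> int \<Rightarrow> ('a::real_vector) grid_fun \<Rightarrow> 'a grid_fun" where
  "flux_x \<alpha> r s F = (\<lambda>(i, j). \<Sum>l\<in>{-r..s}. \<alpha> l *\<^sub>R F (i + l, j))"

definition flux_y :: "(int \<Rightarrow> real) \<Rightarrow> int \<Rightarrow> int \<Rightarrow> ('a::real_vector) grid_fun \<Rightarrow> 'a grid_fun" where
  "flux_y \<alpha> r s F = (\<lambda>(i, j). \<Sum>l\<in>{-r..s}. \<alpha> l *\<^sub>R F (i, j + l))"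

definition delta_x :: "(int \<Rightarrow> real) \<Rightarrow> int \<Rightarrow> int \<Rightarrow> ('a::real_vector) grid_fun \<Rightarrow> 'a grid_fun" where
  "delta_x \<alpha> r s F = (\<lambda>(i, j). flux_x \<alpha> r s F (i, j) - flux_x \<alpha> r s F (i - 1, j))"

definition delta_y :: "(int \<Rightarrow> real) \<Rightarrow> int \<Rightarrow> int \<Rightarrow> ('a::real_vector) grid_fun \<Rightarrow> 'a grid_fun" where
  "delta_y \<alpha> r s F = (\<lambda>(i, j). flux_y \<alpha> r s F (i, j) - flux_y \<alpha> r s F (i, j - 1))"

definition collision :: "real^'l^'k \<Rightarrow> (real^'k \<Rightarrow> real^'l) \<Rightarrow> real^'l \<Rightarrow> real^'l" where
  "collision P Mx f = Mx (P *v f) - f"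

definition L2_op ::
  "(nat \<Rightarrow> real) \<Rightarrow> real^'l^'l \<Rightarrow> real^'l^'l \<Rightarrow> real^'l^'k \<Rightarrow> (real^'k \<Rightarrow> real^'l) \<Rightarrow>
   (int \<Rightarrow> real) \<Rightarrow> int \<Rightarrow> int \<Rightarrow> (int \<Rightarrow> real) \<Rightarrow> int \<Rightarrow> int \<Rightarrow>
   real \<Rightarrow> real \<Rightarrow> real \<Rightarrow> real \<Rightarrow> (real^'l) grid_fun \<Rightarrow>
   (real^'l^('m::{finite,linorder})) grid_fun \<Rightarrow> (real^'l^('m::{finite,linorder})) grid_fun" where
  "L2_op \<beta> \<Lambda>x \<Lambda>y P Mx \<alpha> r s \<alpha>' r' s' dx dy dt \<epsilon> fn F = (\<lambda>l.
     F l - substep_const fn l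
     + (dt / dx) *\<^sub>R substep_map ((*v) \<Lambda>x) (substep_mult (W_mat \<beta>) (delta_x \<alpha> r s F l))
     + (dt / dx) *\<^sub>R substep_map ((*v) \<Lambda>x) (substep_tensor (w0_vec \<beta>) (delta_x \<alpha> r s fn l))
     + (dt / dy) *\<^sub>R substep_map ((*v) \<Lambda>y) (substep_mult (W_mat \<beta>) (delta_y \<alpha>' r' s' F l))
     + (dt / dy) *\<^sub>R substep_map ((*v) \<Lambda>y) (substep_tensor (w0_vec \<beta>) (delta_y \<alpha>' r' s' fn l))
     - (dt / \<epsilon>) *\<^sub>R substep_mult (W_mat \<beta>) (substep_map (collision P Mx) (F l))
     - (dt / \<epsilon>) *\<^sub>R substep_tensor (w0_vec \<beta>) (collision P Mx (fn l)))"

definition L1_op ::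
  "(nat \<Rightarrow> real) \<Rightarrow> real^'l^'l \<Rightarrow> real^'l^'l \<Rightarrow> real^'l^'k \<Rightarrow> (real^'k \<Rightarrow> real^'l) \<Rightarrow>
   (int \<Rightarrow> real) \<Rightarrow> int \<Rightarrow> int \<Rightarrow> (int \<Rightarrow> real) \<Rightarrow> int \<Rightarrow> int \<Rightarrow>
   real \<Rightarrow> real \<Rightarrow> real \<Rightarrow> real \<Rightarrow> (real^'l) grid_fun \<Rightarrow>
   (real^'l^('m::{finite,linorder})) grid_fun \<Rightarrow> (real^'l^('m::{finite,linorder})) grid_fun" where
  "L1_op \<beta> \<Lambda>x \<Lambda>y P Mx \<alpha> r s \<alpha>' r' s' dx dy dt \<epsilon> fn F = (\<lambda>l.
     F l - substep_const fn l
     + (dt / dx) *\<^sub>R substep_mult (B_mat \<beta>)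
         (substep_map ((*v) \<Lambda>x) (delta_x \<alpha> r s (substep_const fn) l))
     + (dt / dy) *\<^sub>R substep_mult (B_mat \<beta>)
         (substep_map ((*v) \<Lambda>y) (delta_y \<alpha>' r' s' (substep_const fn) l))
     - (dt / \<epsilon>) *\<^sub>R substep_mult (W_mat \<beta>) (substep_map (collision P Mx) (F l))
     - (dt / \<epsilon>) *\<^sub>R substep_tensor (w0_vec \<beta>) (collision P Mx (fn l)))"

text \<open>The factor \<open>dx * dy > 0\<close> is irrelevant for summability. \<open>L2_norm\<close> is meaningful only on
  grid functions satisfying \<open>L2_grid\<close>, since \<open>infsum\<close> is 0 for non-summable families.\<close>

definition L2_grid :: "('a::real_normed_vector) grid_fun \<Rightarrow> bool" where
  "L2_grid \<phi> \<longleftrightarrow> (\<lambda>l. (norm (\<phi> l))\<^sup>2) summable_on UNIV"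

definition L2_norm :: "real \<Rightarrow> real \<Rightarrow> ('a::real_normed_vector) grid_fun \<Rightarrow> real" where
  "L2_norm dx dy \<phi> = sqrt (\<Sum>\<^sub>\<infinity>l. dx * dy * (norm (\<phi> l))\<^sup>2)"

text \<open>Solutions of \<open>Lop F = 0\<close> are sought among the grid functions at finite \<open>L\<^sup>2\<close> distance of
  \<open>F0\<close> (for \<open>F0\<close> in \<open>L\<^sup>2\<close>: in \<open>L\<^sup>2\<close>). Among all grid functions uniqueness would fail in general,
  because a homogeneous difference equation on \<open>\<int>\<^sup>2\<close> has exponentially growing solutions.\<close>

definition is_unique_L2_solution ::
  "(('a::real_normed_vector) grid_fun \<Rightarrow> 'a grid_fun) \<Rightarrow> 'a grid_fun \<Rightarrow> 'a grid_fun \<Rightarrow> bool" where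
  "is_unique_L2_solution Lop F0 F \<longleftrightarrow>
     L2_grid (\<lambda>l. F l - F0 l) \<and> (\<forall>l. Lop F l = 0) \<and>
     (\<forall>G. L2_grid (\<lambda>l. G l - F0 l) \<and> (\<forall>l. Lop G l = 0) \<longrightarrow> G = F)"

end

theory Submission
  imports Defs
begin

text \<open>
  Write \<open>E = F - F*\<close> for the error of an iterate \<open>F\<close>, \<open>D\<close> for that of the preceding one, and
  \<open>T = \<Lambda>x \<delta>x D / dx + \<Lambda>y \<delta>y D / dy\<close>. The collision terms of \<open>L1\<close> and \<open>L2\<close> coincide, so they
  cancel in \<open>L1 - L2\<close>, and subtracting the equation of the exact solution from the one of the
  iterate leaves, at every grid point,
  \<open>E - (dt/\<epsilon>) W (Q(F) - Q(F*)) = - dt W T\<close> with \<open>Q(f) = M(P f) - f\<close>.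

  The Lipschitz constant of \<open>M\<close> need not be small, so inverting \<open>Id + (dt/\<epsilon>) W\<close> is not by itself
  enough. The point is that \<open>P Q = 0\<close>: applying \<open>P\<close> removes the stiff term and gives
  \<open>P E = - dt W P T\<close>, which is of size \<open>dt\<close> uniformly in \<open>\<epsilon>\<close>. The Maxwellian enters the
  equation only through \<open>G = M(P F) - M(P F*)\<close>, whose size is controlled by that of \<open>P E\<close>. Hence
  \<open>E = (dt/\<epsilon>) (Id + (dt/\<epsilon>) W)\<^sup>-\<^sup>1 W G - dt (Id + (dt/\<epsilon>) W)\<^sup>-\<^sup>1 W T\<close>, together with the two
  uniform bounds on the matrices, yields a pointwise bound of \<open>E\<close> by a constant times \<open>dt\<close> times the norm of \<open>W T\<close>
  (\<open>defect_step_pointwise\<close>).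

  It remains to sum over the grid: by Minkowski's inequality and translation invariance, the
  difference operators are bounded on \<open>L\<^sup>2\<close> (\<open>L2_delta_x\<close>, \<open>L2_delta_y\<close>). Each iteration thus
  multiplies the norm of the error by at most \<open>\<theta> dt\<close>, and the claim follows by induction.
\<close>

section \<open>The space of square summable grid functions\<close>

lemma L2_norm_eq:
  fixes f :: "'a::real_normed_vector grid_fun"
  assumes "0 < dx" "0 < dy"
  shows "L2_norm dx dy f = sqrt (dx * dy) * sqrt (\<Sum>\<^sub>\<infinity>l. (norm (f l))\<^sup>2)"
  unfolding L2_norm_def by (simp add: infsum_cmult_right' real_sqrt_mult)

text \<open>Up to the factor \<open>sqrt (dx * dy)\<close>, the \<open>L\<^sup>2\<close> norm is the supremum of the Euclidean norms
  over finite parts of the grid. The two halves of this fact transfer Minkowski's inequality from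
  finite sums.\<close>

lemma L2_set_le_L2_norm:
  fixes f :: "'a::real_normed_vector grid_fun"
  assumes "L2_grid f" "finite S"
  shows "L2_set (\<lambda>l. norm (f l)) S \<le> sqrt (\<Sum>\<^sub>\<infinity>l. (norm (f l))\<^sup>2)"
  unfolding L2_set_def
  using assms by (intro real_sqrt_le_mono finite_sum_le_infsum) (auto simp: L2_grid_def)

lemma L2_bounded_by_finite:
  fixes f :: "'a::real_normed_vector grid_fun"
  assumes bound: "\<And>S. finite S \<Longrightarrow> L2_set (\<lambda>l. norm (f l)) S \<le> B"
  shows "L2_grid f" and "sqrt (\<Sum>\<^sub>\<infinity>l. (norm (f l))\<^sup>2) \<le> B"
proof -
  have B: "0 \<le> B"
    using bound[of "{}"] by simp
  have *: "(\<Sum>l\<in>S. (norm (f l))\<^sup>2) \<le> B\<^sup>2" if "finite S" for S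
  proof -
    have "(\<Sum>l\<in>S. (norm (f l))\<^sup>2) = (L2_set (\<lambda>l. norm (f l)) S)\<^sup>2"
      unfolding L2_set_def by (simp add: sum_nonneg)
    also have "\<dots> \<le> B\<^sup>2"
      using bound[OF that] by (intro power_mono) auto
    finally show ?thesis .
  qed
  have summ: "(\<lambda>l. (norm (f l))\<^sup>2) summable_on UNIV"
    by (rule nonneg_bdd_above_summable_on) (auto intro!: bdd_aboveI2[where M = "B\<^sup>2"] *)
  then show "L2_grid f"
    by (simp add: L2_grid_def)
  have "(\<Sum>\<^sub>\<infinity>l. (norm (f l))\<^sup>2) \<le> B\<^sup>2"
    using summ by (rule infsum_le_finite_sums) (use * in auto)
  then show "sqrt (\<Sum>\<^sub>\<infinity>l. (norm (f l))\<^sup>2) \<le> B"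
    using B by (simp add: real_le_lsqrt infsum_nonneg)
qed

lemma L2_mono:
  fixes f :: "'a::real_normed_vector grid_fun" and g :: "'b::real_normed_vector grid_fun"
  assumes "0 < dx" "0 < dy" and g: "L2_grid g" and le: "\<And>l. norm (f l) \<le> norm (g l)"
  shows "L2_grid f" and "L2_norm dx dy f \<le> L2_norm dx dy g"
proof -
  have "L2_set (\<lambda>l. norm (f l)) S \<le> sqrt (\<Sum>\<^sub>\<infinity>l. (norm (g l))\<^sup>2)" if "finite S" for S
    using L2_set_mono[of S "\<lambda>l. norm (f l)" "\<lambda>l. norm (g l)"] L2_set_le_L2_norm[OF g that] le
    by simp
  note b = L2_bounded_by_finite[OF this]
  show "L2_grid f" by (rule b(1))
  show "L2_norm dx dy f \<le> L2_norm dx dy g"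
    unfolding L2_norm_eq[OF assms(1,2)] by (rule mult_left_mono[OF b(2)]) (use assms in auto)
qed

lemma L2_add:
  fixes f g :: "'a::real_normed_vector grid_fun"
  assumes "0 < dx" "0 < dy" and f: "L2_grid f" and g: "L2_grid g"
  shows "L2_grid (\<lambda>l. f l + g l)"
    and "L2_norm dx dy (\<lambda>l. f l + g l) \<le> L2_norm dx dy f + L2_norm dx dy g"
proof -
  let ?n = "\<lambda>f::'a grid_fun. sqrt (\<Sum>\<^sub>\<infinity>l. (norm (f l))\<^sup>2)"
  have "L2_set (\<lambda>l. norm (f l + g l)) S \<le> ?n f + ?n g" if "finite S" for S
  proof -
    have "L2_set (\<lambda>l. norm (f l + g l)) S \<le> L2_set (\<lambda>l. norm (f l) + norm (g l)) S"
      by (intro L2_set_mono) (auto simp: norm_triangle_ineq)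
    also have "\<dots> \<le> L2_set (\<lambda>l. norm (f l)) S + L2_set (\<lambda>l. norm (g l)) S"
      by (rule L2_set_triangle_ineq)
    also have "\<dots> \<le> ?n f + ?n g"
      by (intro add_mono L2_set_le_L2_norm f g that)
    finally show ?thesis .
  qed
  note b = L2_bounded_by_finite[OF this]
  show "L2_grid (\<lambda>l. f l + g l)" by (rule b(1))
  show "L2_norm dx dy (\<lambda>l. f l + g l) \<le> L2_norm dx dy f + L2_norm dx dy g"
    unfolding L2_norm_eq[OF assms(1,2)] distrib_left[symmetric]
    by (rule mult_left_mono[OF b(2)]) (use assms in auto)
qed

lemma L2_scaleR:
  fixes f :: "'a::real_normed_vector grid_fun"
  assumes "L2_grid f"
  shows "L2_grid (\<lambda>l. c *\<^sub>R f l)"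
    and "L2_norm dx dy (\<lambda>l. c *\<^sub>R f l) = \<bar>c\<bar> * L2_norm dx dy f"
proof -
  show "L2_grid (\<lambda>l. c *\<^sub>R f l)"
    using assms unfolding L2_grid_def
    by (auto simp: power_mult_distrib intro: summable_on_cmult_right)
  have "(\<Sum>\<^sub>\<infinity>l. dx * dy * (norm (c *\<^sub>R f l))\<^sup>2) = (\<Sum>\<^sub>\<infinity>l. c\<^sup>2 * (dx * dy * (norm (f l))\<^sup>2))"
    by (simp add: power_mult_distrib mult_ac)
  then show "L2_norm dx dy (\<lambda>l. c *\<^sub>R f l) = \<bar>c\<bar> * L2_norm dx dy f"
    unfolding L2_norm_def by (simp only: infsum_cmult_right' real_sqrt_mult real_sqrt_abs)
qed

lemma L2_norm_of_norm:
  "L2_grid (\<lambda>l. norm (f l)) \<longleftrightarrow> L2_grid f"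
  "L2_norm dx dy (\<lambda>l. norm (f l)) = L2_norm dx dy f"
  by (simp_all add: L2_grid_def L2_norm_def)

lemma L2_diff:
  fixes f g :: "'a::real_normed_vector grid_fun"
  assumes "0 < dx" "0 < dy" "L2_grid f" "L2_grid g"
  shows "L2_grid (\<lambda>l. f l - g l)"
    and "L2_norm dx dy (\<lambda>l. f l - g l) \<le> L2_norm dx dy f + L2_norm dx dy g"
  using L2_add[OF assms(1-3) L2_scaleR(1)[OF assms(4), of "-1"]]
    L2_scaleR(2)[OF assms(4), of dx dy "-1"] by auto

lemma L2_sum:
  fixes f :: "'i \<Rightarrow> 'a::real_normed_vector grid_fun"
  assumes "0 < dx" "0 < dy" "finite I" "\<And>i. i \<in> I \<Longrightarrow> L2_grid (f i)"
  shows "L2_grid (\<lambda>l. \<Sum>i\<in>I. f i l)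
    \<and> L2_norm dx dy (\<lambda>l. \<Sum>i\<in>I. f i l) \<le> (\<Sum>i\<in>I. L2_norm dx dy (f i))"
  using assms(3,4)
proof (induction I rule: finite_induct)
  case empty
  then show ?case by (simp add: L2_grid_def L2_norm_def)
next
  case (insert i I)
  then have fi: "L2_grid (f i)" and IH: "L2_grid (\<lambda>l. \<Sum>i\<in>I. f i l)"
    "L2_norm dx dy (\<lambda>l. \<Sum>i\<in>I. f i l) \<le> (\<Sum>i\<in>I. L2_norm dx dy (f i))"
    by auto
  show ?case
    using L2_add[OF assms(1,2) fi IH(1)] IH(2) insert.hyps by auto
qed

lemma L2_shift:
  fixes f :: "'a::real_normed_vector grid_fun"
  shows "L2_grid (\<lambda>(i, j). f (i + a, j + b)) \<longleftrightarrow> L2_grid f"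
    and "L2_norm dx dy (\<lambda>(i, j). f (i + a, j + b)) = L2_norm dx dy f"
proof -
  let ?t = "\<lambda>l::int \<times> int. (fst l + a, snd l + b)"
  have bij: "bij_betw ?t UNIV UNIV"
    by (rule bij_betwI[where g = "\<lambda>l. (fst l - a, snd l - b)"]) auto
  show "L2_grid (\<lambda>(i, j). f (i + a, j + b)) \<longleftrightarrow> L2_grid f"
    using summable_on_reindex_bij_betw[OF bij, of "\<lambda>l. (norm (f l))\<^sup>2"]
    by (simp add: L2_grid_def case_prod_beta)
  show "L2_norm dx dy (\<lambda>(i, j). f (i + a, j + b)) = L2_norm dx dy f"
    using infsum_reindex_bij_betw[OF bij, of "\<lambda>l. dx * dy * (norm (f l))\<^sup>2"]
    by (simp add: L2_norm_def case_prod_beta)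
qed

section \<open>Difference operators\<close>

lemma L2_flux_x:
  fixes F :: "'a::real_normed_vector grid_fun"
  assumes "0 < dx" "0 < dy" "L2_grid F"
  shows "L2_grid (flux_x \<alpha> r s F)"
    and "L2_norm dx dy (flux_x \<alpha> r s F) \<le> (\<Sum>k\<in>{-r..s}. \<bar>\<alpha> k\<bar>) * L2_norm dx dy F"
proof -
  define f where "f k = (\<lambda>l. \<alpha> k *\<^sub>R (\<lambda>(i, j). F (i + k, j + 0)) l)" for k
  have eq: "flux_x \<alpha> r s F = (\<lambda>l. \<Sum>k\<in>{-r..s}. f k l)"
    by (auto simp: flux_x_def f_def)
  have shift: "L2_grid (\<lambda>(i, j). F (i + k, j + 0))" for k
    using assms(3) by (simp only: L2_shift)
  have "L2_grid (f k)" "L2_norm dx dy (f k) = \<bar>\<alpha> k\<bar> * L2_norm dx dy F" for k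
    unfolding f_def using L2_scaleR[OF shift] by (simp_all only: L2_shift)
  then show "L2_grid (flux_x \<alpha> r s F)"
    and "L2_norm dx dy (flux_x \<alpha> r s F) \<le> (\<Sum>k\<in>{-r..s}. \<bar>\<alpha> k\<bar>) * L2_norm dx dy F"
    using L2_sum[OF assms(1,2), of "{-r..s}" f] by (simp_all add: eq sum_distrib_right)
qed

lemma L2_flux_y:
  fixes F :: "'a::real_normed_vector grid_fun"
  assumes "0 < dx" "0 < dy" "L2_grid F"
  shows "L2_grid (flux_y \<alpha> r s F)"
    and "L2_norm dx dy (flux_y \<alpha> r s F) \<le> (\<Sum>k\<in>{-r..s}. \<bar>\<alpha> k\<bar>) * L2_norm dx dy F"
proof -
  define f where "f k = (\<lambda>l. \<alpha> k *\<^sub>R (\<lambda>(i, j). F (i + 0, j + k)) l)" for k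
  have eq: "flux_y \<alpha> r s F = (\<lambda>l. \<Sum>k\<in>{-r..s}. f k l)"
    by (auto simp: flux_y_def f_def)
  have shift: "L2_grid (\<lambda>(i, j). F (i + 0, j + k))" for k
    using assms(3) by (simp only: L2_shift)
  have "L2_grid (f k)" "L2_norm dx dy (f k) = \<bar>\<alpha> k\<bar> * L2_norm dx dy F" for k
    unfolding f_def using L2_scaleR[OF shift] by (simp_all only: L2_shift)
  then show "L2_grid (flux_y \<alpha> r s F)"
    and "L2_norm dx dy (flux_y \<alpha> r s F) \<le> (\<Sum>k\<in>{-r..s}. \<bar>\<alpha> k\<bar>) * L2_norm dx dy F"
    using L2_sum[OF assms(1,2), of "{-r..s}" f] by (simp_all add: eq sum_distrib_right)
qed

lemma L2_delta_x:
  fixes F :: "'a::real_normed_vector grid_fun"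
  assumes "0 < dx" "0 < dy" "L2_grid F"
  shows "L2_grid (delta_x \<alpha> r s F)"
    and "L2_norm dx dy (delta_x \<alpha> r s F) \<le> 2 * (\<Sum>k\<in>{-r..s}. \<bar>\<alpha> k\<bar>) * L2_norm dx dy F"
proof -
  note flux = L2_flux_x[OF assms, of \<alpha> r s]
  have eq: "delta_x \<alpha> r s F
      = (\<lambda>l. flux_x \<alpha> r s F l - (\<lambda>(i, j). flux_x \<alpha> r s F (i + (-1), j + 0)) l)"
    by (auto simp: delta_x_def)
  have "L2_grid (\<lambda>(i, j). flux_x \<alpha> r s F (i + (-1), j + 0))"
    using flux(1) by (simp only: L2_shift)
  note diff = L2_diff[OF assms(1,2) flux(1) this]
  show "L2_grid (delta_x \<alpha> r s F)"
    unfolding eq by (rule diff(1))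
  show "L2_norm dx dy (delta_x \<alpha> r s F) \<le> 2 * (\<Sum>k\<in>{-r..s}. \<bar>\<alpha> k\<bar>) * L2_norm dx dy F"
    using diff(2) flux(2) unfolding eq L2_shift by linarith
qed

lemma L2_delta_y:
  fixes F :: "'a::real_normed_vector grid_fun"
  assumes "0 < dx" "0 < dy" "L2_grid F"
  shows "L2_grid (delta_y \<alpha> r s F)"
    and "L2_norm dx dy (delta_y \<alpha> r s F) \<le> 2 * (\<Sum>k\<in>{-r..s}. \<bar>\<alpha> k\<bar>) * L2_norm dx dy F"
proof -
  note flux = L2_flux_y[OF assms, of \<alpha> r s]
  have eq: "delta_y \<alpha> r s F
      = (\<lambda>l. flux_y \<alpha> r s F l - (\<lambda>(i, j). flux_y \<alpha> r s F (i + 0, j + (-1))) l)"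
    by (auto simp: delta_y_def)
  have "L2_grid (\<lambda>(i, j). flux_y \<alpha> r s F (i + 0, j + (-1)))"
    using flux(1) by (simp only: L2_shift)
  note diff = L2_diff[OF assms(1,2) flux(1) this]
  show "L2_grid (delta_y \<alpha> r s F)"
    unfolding eq by (rule diff(1))
  show "L2_norm dx dy (delta_y \<alpha> r s F) \<le> 2 * (\<Sum>k\<in>{-r..s}. \<bar>\<alpha> k\<bar>) * L2_norm dx dy F"
    using diff(2) flux(2) unfolding eq L2_shift by linarith
qed

lemma delta_x_diff:
  "delta_x \<alpha> r s (\<lambda>l. F l - G l) l = delta_x \<alpha> r s F l - delta_x \<alpha> r s G l"
  by (cases l) (simp add: delta_x_def flux_x_def scaleR_diff_right sum_subtractf)

lemma delta_y_diff:
  "delta_y \<alpha> r s (\<lambda>l. F l - G l) l = delta_y \<alpha> r s F l - delta_y \<alpha> r s G l"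
  by (cases l) (simp add: delta_y_def flux_y_def scaleR_diff_right sum_subtractf)

section \<open>Matrices and maps acting on vectors of sub-steps\<close>

lemma substep_mult_diff: "substep_mult A (V - U) = substep_mult A V - substep_mult A U"
  by (simp add: substep_mult_def vec_eq_iff scaleR_diff_right sum_subtractf)

lemma substep_mult_add: "substep_mult A (V + U) = substep_mult A V + substep_mult A U"
  by (simp add: substep_mult_def vec_eq_iff scaleR_add_right sum.distrib)

lemma substep_mult_scaleR: "substep_mult A (c *\<^sub>R V) = c *\<^sub>R substep_mult A V"
  by (simp add: substep_mult_def vec_eq_iff scaleR_sum_right mult.commute)

lemma substep_mult_mat_add: "substep_mult (A + B) V = substep_mult A V + substep_mult B V"
  by (simp add: substep_mult_def vec_eq_iff scaleR_add_left sum.distrib)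

lemma substep_mult_mat_scaleR: "substep_mult (c *\<^sub>R A) V = c *\<^sub>R substep_mult A V"
  by (simp add: substep_mult_def vec_eq_iff scaleR_sum_right)

lemma substep_mult_mat_1: "substep_mult (mat 1) V = V"
  by (simp add: substep_mult_def vec_eq_iff mat_def if_distrib[of "\<lambda>x. x *\<^sub>R _"] cong: if_cong)

lemma substep_mult_assoc: "substep_mult (A ** B) V = substep_mult A (substep_mult B V)"
proof -
  have "(\<Sum>q\<in>UNIV. (\<Sum>k\<in>UNIV. A $ p $ k * B $ k $ q) *\<^sub>R V $ q)
      = (\<Sum>k\<in>UNIV. A $ p $ k *\<^sub>R (\<Sum>q\<in>UNIV. B $ k $ q *\<^sub>R V $ q))" for p
    unfolding scaleR_sum_left scaleR_sum_right by (subst sum.swap) simp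
  then show ?thesis
    by (simp add: substep_mult_def matrix_matrix_mult_def)
qed

text \<open>A linear map acting on each sub-step commutes with a matrix acting on the sub-step index.\<close>

lemma substep_map_mult:
  assumes "linear h"
  shows "substep_map h (substep_mult A V) = substep_mult A (substep_map h V)"
  by (simp add: substep_map_def substep_mult_def vec_eq_iff linear_sum[OF assms]
      linear_cmul[OF assms])

lemma substep_map_scaleR:
  assumes "linear h"
  shows "substep_map h (c *\<^sub>R V) = c *\<^sub>R substep_map h V"
  by (simp add: substep_map_def vec_eq_iff linear_cmul[OF assms])

lemma substep_map_diff:
  assumes "linear h"
  shows "substep_map h (V - U) = substep_map h V - substep_map h U"
  by (simp add: substep_map_def vec_eq_iff linear_diff[OF assms])

lemma norm_vec_le:
  fixes V :: "'a::real_normed_vector^'m" and U :: "'b::real_normed_vector^'m"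
  assumes "0 \<le> C" "\<And>p. norm (V $ p) \<le> C * norm (U $ p)"
  shows "norm V \<le> C * norm U"
proof -
  have "norm V \<le> L2_set (\<lambda>p. C * norm (U $ p)) UNIV"
    unfolding norm_vec_def using assms(2) by (intro L2_set_mono) auto
  also have "\<dots> = C * norm U"
    unfolding norm_vec_def using assms(1) by (rule L2_set_right_distrib[symmetric])
  finally show ?thesis .
qed

lemma norm_substep_map_matrix_le:
  fixes A :: "real^'l^'k" and V :: "real^'l^'m"
  shows "norm (substep_map ((*v) A) V) \<le> onorm ((*v) A) * norm V"
  by (intro norm_vec_le)
    (auto simp: substep_map_def intro!: onorm onorm_pos_le matrix_vector_mul_bounded_linear)

text \<open>The operator norm of a matrix does not grow when it acts on vectors of vectors: the
  squared Euclidean norm is the sum of those of the components, on each of which the matrix acts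
  as usual.\<close>

lemma norm_substep_mult_le:
  fixes A :: "real^'m^'m" and V :: "real^'l^'m"
  shows "norm (substep_mult A V) \<le> onorm ((*v) A) * norm V"
proof -
  have bl: "bounded_linear ((*v) A)"
    by (rule matrix_vector_mul_bounded_linear)
  have sq: "(norm U)\<^sup>2 = (\<Sum>j\<in>UNIV. (norm (\<chi> p. U $ p $ j))\<^sup>2)" for U :: "real^'l^'m"
    unfolding norm_vec_def L2_set_def
    by (simp add: sum_nonneg) (rule sum.swap)
  have col: "(\<chi> p. substep_mult A V $ p $ j) = A *v (\<chi> p. V $ p $ j)" for j
    by (simp add: substep_mult_def matrix_vector_mult_def vec_eq_iff)
  have "(norm (substep_mult A V))\<^sup>2 = (\<Sum>j\<in>UNIV. (norm (A *v (\<chi> p. V $ p $ j)))\<^sup>2)"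
    unfolding sq[of "substep_mult A V"] col ..
  also have "\<dots> \<le> (\<Sum>j\<in>UNIV. (onorm ((*v) A) * norm (\<chi> p. V $ p $ j))\<^sup>2)"
    by (intro sum_mono power_mono onorm[OF bl]) auto
  also have "\<dots> = (onorm ((*v) A) * norm V)\<^sup>2"
    unfolding power_mult_distrib sq[of V] sum_distrib_left ..
  finally show ?thesis
    by (rule power2_le_imp_le) (simp add: onorm_pos_le[OF bl])
qed

section \<open>One step of the defect correction\<close>

text \<open>The error equation at a grid point. Here \<open>V\<close> and \<open>U\<close> stand for the values of the new
  iterate and of the exact solution, and \<open>T\<close> for the transport term of the previous error. The
  bound does not see \<open>\<epsilon>\<close> because \<open>P\<close> annihilates the collision operator.\<close>

lemma defect_step_pointwise:
  fixes V U T :: "real^'l^'m" and W :: "real^'m^'m" and P :: "real^'l^'k"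
  assumes lip: "C-lipschitz_on UNIV Mx"
    and PM: "\<And>u. P *v Mx u = u"
    and dt: "0 < dt" "0 < \<epsilon>"
    and inv: "invertible (mat 1 + (dt / \<epsilon>) *\<^sub>R W)"
    and \<gamma>: "onorm ((*v) (matrix_inv (mat 1 + (dt / \<epsilon>) *\<^sub>R W))) \<le> \<gamma>"
    and \<gamma>': "dt / \<epsilon> * onorm ((*v) (matrix_inv (mat 1 + (dt / \<epsilon>) *\<^sub>R W) ** W)) \<le> \<gamma>'"
    and eq: "V - U - (dt / \<epsilon>) *\<^sub>R substep_mult W
               (substep_map (collision P Mx) V - substep_map (collision P Mx) U)
             = - dt *\<^sub>R substep_mult W T"
  shows "norm (V - U)
    \<le> dt * ((\<gamma>' * C * onorm ((*v) P) + \<gamma>) * norm (substep_mult W T))"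
proof -
  define J where "J = matrix_inv (mat 1 + (dt / \<epsilon>) *\<^sub>R W)"
  define Q where "Q = substep_map (collision P Mx) V - substep_map (collision P Mx) U"
  define G :: "real^'l^'m" where "G = (\<chi> p. Mx (P *v V $ p) - Mx (P *v U $ p))"
  define R where "R = substep_mult W T"
  have linP: "linear ((*v) P)"
    by (rule matrix_vector_mul_linear)
  have C: "0 \<le> C"
    using lip by (rule lipschitz_on_nonneg)
  have "0 \<le> dt / \<epsilon> * onorm ((*v) (J ** W))"
    using dt by (simp add: onorm_pos_le matrix_vector_mul_bounded_linear)
  then have \<gamma>'_nonneg: "0 \<le> \<gamma>'"
    using \<gamma>' unfolding J_def by linarith
  have PQ: "substep_map ((*v) P) Q = 0"
    by (simp add: Q_def substep_map_def collision_def vec_eq_iff matrix_vector_mult_diff_distrib PM)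
  have eqQ: "V - U - (dt / \<epsilon>) *\<^sub>R substep_mult W Q = - dt *\<^sub>R R"
    using eq by (simp add: Q_def R_def)
  \<comment> \<open>\<open>P\<close> removes the stiff term, so the moments of the error are of size \<open>dt\<close>.\<close>
  have "substep_map ((*v) P) (V - U) = substep_map ((*v) P) (- dt *\<^sub>R R)"
  proof -
    have "substep_mult W (0 :: real^'k^'m) = 0"
      by (simp add: substep_mult_def vec_eq_iff)
    then have "substep_map ((*v) P) ((dt / \<epsilon>) *\<^sub>R substep_mult W Q) = 0"
      by (simp only: substep_map_scaleR[OF linP] substep_map_mult[OF linP] PQ scaleR_zero_right)
    then show ?thesis
      unfolding eqQ[symmetric] by (simp add: substep_map_diff[OF linP])
  qed
  then have "norm (substep_map ((*v) P) (V - U)) \<le> onorm ((*v) P) * norm (- dt *\<^sub>R R)"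
    by (simp only: norm_substep_map_matrix_le)
  then have PE: "norm (substep_map ((*v) P) (V - U)) \<le> onorm ((*v) P) * (dt * norm R)"
    using dt by simp
  have "norm G \<le> C * norm (substep_map ((*v) P) (V - U))"
  proof (rule norm_vec_le[OF C])
    show "norm (G $ p) \<le> C * norm (substep_map ((*v) P) (V - U) $ p)" for p
      using lipschitz_onD[OF lip, of "P *v V $ p" "P *v U $ p"]
      by (simp add: G_def substep_map_def dist_norm matrix_vector_mult_diff_distrib)
  qed
  also have "\<dots> \<le> C * (onorm ((*v) P) * (dt * norm R))"
    by (intro mult_left_mono PE C)
  finally have G: "norm G \<le> C * (onorm ((*v) P) * (dt * norm R))" .
  \<comment> \<open>The linear part of the relaxation goes to the left-hand side; only the Maxwellian remains
    on the right.\<close>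
  have "G = Q + (V - U)"
    by (simp add: Q_def G_def substep_map_def collision_def vec_eq_iff)
  then have "substep_mult W G = substep_mult W Q + substep_mult W (V - U)"
    by (simp only: substep_mult_add)
  then have "substep_mult (mat 1 + (dt / \<epsilon>) *\<^sub>R W) (V - U)
      = (dt / \<epsilon>) *\<^sub>R substep_mult W G - dt *\<^sub>R R"
    using eqQ by (simp add: substep_mult_mat_add substep_mult_mat_scaleR substep_mult_mat_1
        algebra_simps)
  then have "substep_mult (J ** (mat 1 + (dt / \<epsilon>) *\<^sub>R W)) (V - U)
      = substep_mult J ((dt / \<epsilon>) *\<^sub>R substep_mult W G - dt *\<^sub>R R)"
    by (simp only: substep_mult_assoc)
  also have "\<dots> = (dt / \<epsilon>) *\<^sub>R substep_mult (J ** W) G - dt *\<^sub>R substep_mult J R"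
    by (simp only: substep_mult_assoc substep_mult_diff substep_mult_scaleR)
  finally have "substep_mult (J ** (mat 1 + (dt / \<epsilon>) *\<^sub>R W)) (V - U)
      = (dt / \<epsilon>) *\<^sub>R substep_mult (J ** W) G - dt *\<^sub>R substep_mult J R" .
  moreover have "J ** (mat 1 + (dt / \<epsilon>) *\<^sub>R W) = mat 1"
    using someI_ex[OF inv[unfolded invertible_def]] by (simp add: J_def matrix_inv_def)
  ultimately have E: "V - U = (dt / \<epsilon>) *\<^sub>R substep_mult (J ** W) G - dt *\<^sub>R substep_mult J R"
    by (simp add: substep_mult_mat_1)
  have "norm (V - U) \<le> dt / \<epsilon> * norm (substep_mult (J ** W) G) + dt * norm (substep_mult J R)"
    unfolding E using dt by (intro order_trans[OF norm_triangle_ineq4]) simp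
  also have "dt / \<epsilon> * norm (substep_mult (J ** W) G)
      \<le> dt / \<epsilon> * (onorm ((*v) (J ** W)) * norm G)"
    using dt by (intro mult_left_mono norm_substep_mult_le) auto
  also have "\<dots> \<le> \<gamma>' * norm G"
    using mult_right_mono[OF \<gamma>' norm_ge_zero[of G]] by (simp add: J_def mult.assoc)
  also have "\<dots> \<le> \<gamma>' * (C * (onorm ((*v) P) * (dt * norm R)))"
    by (intro mult_left_mono G \<gamma>'_nonneg)
  also have "norm (substep_mult J R) \<le> \<gamma> * norm R"
    using norm_substep_mult_le[of J R] mult_right_mono[OF \<gamma> norm_ge_zero[of R]]
    by (simp add: J_def)
  finally show ?thesis
    using dt by (simp add: R_def algebra_simps)
qed

text \<open>Subtracting the equation of the exact solution from the one of the iterate: the transport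
  terms of \<open>L1\<close> depend on \<open>fn\<close> only and cancel, and so do the collision terms of the old iterate,
  which are common to \<open>L1\<close> and \<open>L2\<close>.\<close>

lemma defect_error_equation:
  fixes F F' Fstar :: "(real^'l^('m::{finite,linorder})) grid_fun"
  assumes step: "L1_op \<beta> \<Lambda>x \<Lambda>y P Mx \<alpha> r s \<alpha>' r' s' dx dy dt \<epsilon> fn F' l
      = L1_op \<beta> \<Lambda>x \<Lambda>y P Mx \<alpha> r s \<alpha>' r' s' dx dy dt \<epsilon> fn F l
        - L2_op \<beta> \<Lambda>x \<Lambda>y P Mx \<alpha> r s \<alpha>' r' s' dx dy dt \<epsilon> fn F l"
    and sol: "L2_op \<beta> \<Lambda>x \<Lambda>y P Mx \<alpha> r s \<alpha>' r' s' dx dy dt \<epsilon> fn Fstar l = 0"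
  defines "D \<equiv> \<lambda>l. F l - Fstar l"
  shows "F' l - Fstar l - (dt / \<epsilon>) *\<^sub>R substep_mult (W_mat \<beta>)
           (substep_map (collision P Mx) (F' l) - substep_map (collision P Mx) (Fstar l))
         = - dt *\<^sub>R substep_mult (W_mat \<beta>)
             ((1 / dx) *\<^sub>R substep_map ((*v) \<Lambda>x) (delta_x \<alpha> r s D l)
              + (1 / dy) *\<^sub>R substep_map ((*v) \<Lambda>y) (delta_y \<alpha>' r' s' D l))"
proof -
  note lin = matrix_vector_mul_linear
  define W where "W = (W_mat \<beta> :: real^('m::{finite,linorder})^('m::{finite,linorder}))"
  define X where "X H = substep_mult W (substep_map ((*v) \<Lambda>x) (delta_x \<alpha> r s H l))"
    for H :: "(real^'l^('m::{finite,linorder})) grid_fun"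
  define Y where "Y H = substep_mult W (substep_map ((*v) \<Lambda>y) (delta_y \<alpha>' r' s' H l))"
    for H :: "(real^'l^('m::{finite,linorder})) grid_fun"
  have cancel: "v - u - (q - q') = x' + y' - (x + y)"
    if eq: "v - c + b1 + b2 - q - w
        = (f - c + b1 + b2 - p - w) - (f - c + x + x0 + y + y0 - p - w)"
      and eq': "u - c + x' + x0 + y' + y0 - q' - w = 0"
    for v u f c b1 b2 q q' p w x x' x0 y y' y0 :: "real^'l^('m::{finite,linorder})"
  proof -
    have "v = c + q + w - (x + x0 + y + y0)" and "u = c + q' + w - (x' + x0 + y' + y0)"
      using eq eq' by (simp_all add: algebra_simps eq_diff_eq)
    then show ?thesis
      by simp
  qed
  have "F' l - Fstar l
      - ((dt / \<epsilon>) *\<^sub>R substep_mult W (substep_map (collision P Mx) (F' l))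
         - (dt / \<epsilon>) *\<^sub>R substep_mult W (substep_map (collision P Mx) (Fstar l)))
      = (dt / dx) *\<^sub>R X Fstar + (dt / dy) *\<^sub>R Y Fstar - ((dt / dx) *\<^sub>R X F + (dt / dy) *\<^sub>R Y F)"
    by (rule cancel[OF step[unfolded L1_op_def L2_op_def substep_map_mult[OF lin]
            W_def[symmetric] X_def[symmetric] Y_def[symmetric]]
          sol[unfolded L2_op_def substep_map_mult[OF lin]
            W_def[symmetric] X_def[symmetric] Y_def[symmetric]]])
  also have "\<dots> = - dt *\<^sub>R ((1 / dx) *\<^sub>R X D + (1 / dy) *\<^sub>R Y D)"
  proof -
    have "X D = X F - X Fstar" "Y D = Y F - Y Fstar"
      unfolding X_def Y_def D_def delta_x_diff delta_y_diff substep_map_diff[OF lin]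
        substep_mult_diff by simp_all
    then show ?thesis
      by (simp only:) (simp add: algebra_simps)
  qed
  finally show ?thesis
    unfolding W_def[symmetric] substep_mult_diff substep_mult_add substep_mult_scaleR
      X_def[symmetric] Y_def[symmetric]
    by (simp add: scaleR_diff_right)
qed


theorem proposition2p3:
  fixes A1 A2 :: "real^'k \<Rightarrow> real^'k"
    and \<Lambda>x \<Lambda>y :: "real^'l^'l"
    and P :: "real^'l^'k"
    and Mx :: "real^'k \<Rightarrow> real^'l"
    and \<beta> :: "nat \<Rightarrow> real"
    and \<alpha> \<alpha>' :: "int \<Rightarrow> real"
    and r0 s0 r0' s0' :: int
    and dx dy \<gamma> \<gamma>' :: real
    and adm :: "(real \<times> real) set"  \<comment> \<open>the pairs (time step, \<open>\<epsilon>\<close>) under consideration\<close>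
  assumes "local_lipschitz (UNIV :: real set) UNIV (\<lambda>_. A1)"
    and "local_lipschitz (UNIV :: real set) UNIV (\<lambda>_. A2)"
    and "\<And>i j. i \<noteq> j \<Longrightarrow> \<Lambda>x $ i $ j = 0"
    and "\<And>i j. i \<noteq> j \<Longrightarrow> \<Lambda>y $ i $ j = 0"
    and "\<exists>C. C-lipschitz_on UNIV Mx"
    and "\<And>u. P *v Mx u = u"
    and "\<And>u. P *v (\<Lambda>x *v Mx u) = A1 u"
    and "\<And>u. P *v (\<Lambda>y *v Mx u) = A2 u"
    and "\<beta> 0 = 0"
    and "\<And>p. p < CARD('m::{finite,linorder}) \<Longrightarrow> \<beta> p < \<beta> (Suc p)"
    and "\<beta> CARD('m) = 1"
    and "0 < dx" and "0 < dy"
    and "0 < \<gamma>" and "0 < \<gamma>'"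
    and "\<And>dt \<epsilon>. (dt, \<epsilon>) \<in> adm \<Longrightarrow> 0 < dt \<and> 0 < \<epsilon>"
    and "\<And>dt \<epsilon>. (dt, \<epsilon>) \<in> adm \<Longrightarrow>
           invertible (mat 1 + (dt / \<epsilon>) *\<^sub>R (W_mat \<beta> :: real^('m::{finite,linorder})^('m::{finite,linorder})))"
    and "\<And>dt \<epsilon>. (dt, \<epsilon>) \<in> adm \<Longrightarrow>
           onorm ((*v) (matrix_inv (mat 1 + (dt / \<epsilon>) *\<^sub>R (W_mat \<beta> :: real^('m::{finite,linorder})^('m::{finite,linorder}))))) \<le> \<gamma>"
    and "\<And>dt \<epsilon>. (dt, \<epsilon>) \<in> adm \<Longrightarrow>
           dt / \<epsilon> * onorm ((*v) (matrix_inv (mat 1 + (dt / \<epsilon>) *\<^sub>R (W_mat \<beta> :: real^('m::{finite,linorder})^('m::{finite,linorder}))) ** W_mat \<beta>))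
             \<le> \<gamma>'"
  shows "\<exists>\<theta>::real. \<forall>(dt, \<epsilon>) \<in> adm.
           \<forall>(fn :: (real^'l) grid_fun) (Fstar :: (real^'l^('m::{finite,linorder})) grid_fun)
             (F :: nat \<Rightarrow> (real^'l^('m::{finite,linorder})) grid_fun).
             (let L1 = L1_op \<beta> \<Lambda>x \<Lambda>y P Mx \<alpha> r0 s0 \<alpha>' r0' s0' dx dy dt \<epsilon> fn;
                  L2 = L2_op \<beta> \<Lambda>x \<Lambda>y P Mx \<alpha> r0 s0 \<alpha>' r0' s0' dx dy dt \<epsilon> fn
              in is_unique_L2_solution L2 (substep_const fn) Fstar \<longrightarrow>
                 F 0 = substep_const fn \<longrightarrow>
                 (\<forall>r l. L1 (F (Suc r)) l = L1 (F r) l - L2 (F r) l) \<longrightarrow>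
                 (\<forall>r. L2_grid (\<lambda>l. F (Suc r) l - Fstar l) \<and>
                      L2_norm dx dy (\<lambda>l. F (Suc r) l - Fstar l)
                        \<le> (\<theta> * dt) ^ Suc r * L2_norm dx dy (\<lambda>l. F 0 l - Fstar l)))"
proof -
  let ?W = "W_mat \<beta> :: real^('m::{finite,linorder})^('m::{finite,linorder})"
  obtain C where C: "C-lipschitz_on UNIV Mx"
    using assms(5) by blast
  have C0: "0 \<le> C"
    using C by (rule lipschitz_on_nonneg)
  have on: "0 \<le> onorm ((*v) A)" for A :: "real^'a^'b"
    by (simp add: onorm_pos_le matrix_vector_mul_bounded_linear)
  define K where "K = (\<gamma>' * C * onorm ((*v) P) + \<gamma>) * onorm ((*v) ?W)"
  define cx where "cx = onorm ((*v) \<Lambda>x) / dx"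
  define cy where "cy = onorm ((*v) \<Lambda>y) / dy"
  define ax where "ax = 2 * (\<Sum>k\<in>{-r0..s0}. \<bar>\<alpha> k\<bar>)"
  define ay where "ay = 2 * (\<Sum>k\<in>{-r0'..s0'}. \<bar>\<alpha>' k\<bar>)"
  define \<theta> where "\<theta> = K * (cx * ax + cy * ay)"
  have cxy: "0 \<le> cx" "0 \<le> cy"
    using \<open>0 < dx\<close> \<open>0 < dy\<close> by (auto simp: cx_def cy_def intro!: divide_nonneg_pos on)
  have K0: "0 \<le> K"
    unfolding K_def using \<open>0 < \<gamma>\<close> \<open>0 < \<gamma>'\<close> C0 on[of P] on[of ?W] by auto
  have ax0: "0 \<le> ax" "0 \<le> ay"
    by (auto simp: ax_def ay_def sum_nonneg)
  have \<theta>0: "0 \<le> \<theta>"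
    using cxy K0 ax0 by (simp add: \<theta>_def)
  show ?thesis
  proof (intro exI[of _ \<theta>] ballI, clarify, unfold Let_def, intro impI)
    fix dt \<epsilon> :: real and fn :: "(real^'l) grid_fun"
      and Fstar :: "(real^'l^('m::{finite,linorder})) grid_fun" and F :: "nat \<Rightarrow> (real^'l^('m::{finite,linorder})) grid_fun"
    let ?L1 = "L1_op \<beta> \<Lambda>x \<Lambda>y P Mx \<alpha> r0 s0 \<alpha>' r0' s0' dx dy dt \<epsilon> fn
      :: (real^'l^('m::{finite,linorder})) grid_fun \<Rightarrow> (real^'l^('m::{finite,linorder})) grid_fun"
    let ?L2 = "L2_op \<beta> \<Lambda>x \<Lambda>y P Mx \<alpha> r0 s0 \<alpha>' r0' s0' dx dy dt \<epsilon> fn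
      :: (real^'l^('m::{finite,linorder})) grid_fun \<Rightarrow> (real^'l^('m::{finite,linorder})) grid_fun"
    assume adm: "(dt, \<epsilon>) \<in> adm"
      and sol: "is_unique_L2_solution ?L2 (substep_const fn) Fstar"
      and F0: "F 0 = substep_const fn"
      and step: "\<forall>r l. ?L1 (F (Suc r)) l = ?L1 (F r) l - ?L2 (F r) l"
    have dt: "0 < dt" "0 < \<epsilon>"
      using assms(16)[OF adm] by auto
    define E where "E r l = F r l - Fstar l" for r l
    have E0: "L2_grid (E 0)"
    proof -
      have "L2_grid (\<lambda>l. Fstar l - F 0 l)"
        using sol by (simp add: is_unique_L2_solution_def F0)
      then show ?thesis
        by (simp add: L2_grid_def E_def norm_minus_commute)
    qed
    define H where "H r l = cx * norm (delta_x \<alpha> r0 s0 (E r) l)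
      + cy * norm (delta_y \<alpha>' r0' s0' (E r) l)" for r l
    have pointwise: "norm (E (Suc r) l) \<le> norm ((dt * K) *\<^sub>R H r l)" for r l
    proof -
      define Tx where "Tx = (1 / dx) *\<^sub>R substep_map ((*v) \<Lambda>x) (delta_x \<alpha> r0 s0 (E r) l)"
      define Ty where "Ty = (1 / dy) *\<^sub>R substep_map ((*v) \<Lambda>y) (delta_y \<alpha>' r0' s0' (E r) l)"
      have T: "norm Tx \<le> cx * norm (delta_x \<alpha> r0 s0 (E r) l)"
        "norm Ty \<le> cy * norm (delta_y \<alpha>' r0' s0' (E r) l)"
        using \<open>0 < dx\<close> \<open>0 < dy\<close>
          norm_substep_map_matrix_le[of \<Lambda>x "delta_x \<alpha> r0 s0 (E r) l"]
          norm_substep_map_matrix_le[of \<Lambda>y "delta_y \<alpha>' r0' s0' (E r) l"]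
        by (auto simp: Tx_def Ty_def cx_def cy_def divide_right_mono)
      have "?L2 Fstar l = 0"
        using sol unfolding is_unique_L2_solution_def by blast
      note eq = defect_error_equation[OF step[rule_format, of r l] this]
      have "norm (E (Suc r) l)
          \<le> dt * ((\<gamma>' * C * onorm ((*v) P) + \<gamma>) * norm (substep_mult ?W (Tx + Ty)))"
        unfolding E_def[of "Suc r"]
      proof (rule defect_step_pointwise[OF C assms(6) dt assms(17)[OF adm] assms(18)[OF adm]
            assms(19)[OF adm]])
        show "F (Suc r) l - Fstar l - (dt / \<epsilon>) *\<^sub>R substep_mult ?W
            (substep_map (collision P Mx) (F (Suc r) l) - substep_map (collision P Mx) (Fstar l))
            = - dt *\<^sub>R substep_mult ?W (Tx + Ty)"
          using eq unfolding Tx_def Ty_def E_def .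
      qed
      also have "\<dots> \<le> dt * ((\<gamma>' * C * onorm ((*v) P) + \<gamma>) * (onorm ((*v) ?W) * H r l))"
      proof -
        have "norm (Tx + Ty) \<le> H r l"
          using norm_triangle_ineq[of Tx Ty] T by (simp add: H_def)
        then have "norm (substep_mult ?W (Tx + Ty)) \<le> onorm ((*v) ?W) * H r l"
          using norm_substep_mult_le[of ?W "Tx + Ty"] mult_left_mono[OF _ on[of ?W]]
          by (meson order_trans)
        then show ?thesis
          using dt \<open>0 < \<gamma>\<close> \<open>0 < \<gamma>'\<close> C0 on[of P] by (intro mult_left_mono) auto
      qed
      also have "\<dots> = (dt * K) *\<^sub>R H r l"
        by (simp add: K_def)
      finally show ?thesis
        by simp
    qed
    have contract: "L2_grid (E (Suc r))
        \<and> L2_norm dx dy (E (Suc r)) \<le> (\<theta> * dt) * L2_norm dx dy (E r)"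
      if Er: "L2_grid (E r)" for r
    proof -
      let ?N = "L2_norm dx dy (E r)"
      define hx where "hx l = cx *\<^sub>R norm (delta_x \<alpha> r0 s0 (E r) l)" for l
      define hy where "hy l = cy *\<^sub>R norm (delta_y \<alpha>' r0' s0' (E r) l)" for l
      note dX = L2_delta_x[OF \<open>0 < dx\<close> \<open>0 < dy\<close> Er, of \<alpha> r0 s0, folded ax_def]
      note dY = L2_delta_y[OF \<open>0 < dx\<close> \<open>0 < dy\<close> Er, of \<alpha>' r0' s0', folded ay_def]
      have hx: "L2_grid hx" "L2_norm dx dy hx \<le> cx * (ax * ?N)"
        using L2_scaleR[where f = "\<lambda>l. norm (delta_x \<alpha> r0 s0 (E r) l)" and c = cx] dX cxy(1)
        unfolding hx_def[abs_def] by (auto simp: L2_norm_of_norm mult_left_mono)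
      have hy: "L2_grid hy" "L2_norm dx dy hy \<le> cy * (ay * ?N)"
        using L2_scaleR[where f = "\<lambda>l. norm (delta_y \<alpha>' r0' s0' (E r) l)" and c = cy] dY cxy(2)
        unfolding hy_def[abs_def] by (auto simp: L2_norm_of_norm mult_left_mono)
      have H: "H r = (\<lambda>l. hx l + hy l)"
        by (simp add: H_def hx_def hy_def fun_eq_iff)
      note add = L2_add[OF \<open>0 < dx\<close> \<open>0 < dy\<close> hx(1) hy(1), folded H]
      note mono = L2_mono[OF \<open>0 < dx\<close> \<open>0 < dy\<close> L2_scaleR(1)[OF add(1)] pointwise]
      have "L2_norm dx dy (E (Suc r)) \<le> (dt * K) * L2_norm dx dy (H r)"
        using mono(2) L2_scaleR(2)[OF add(1)] dt K0 by simp
      also have "\<dots> \<le> (dt * K) * (cx * (ax * ?N) + cy * (ay * ?N))"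
        using add(2) hx(2) hy(2) dt K0 by (intro mult_left_mono) auto
      also have "\<dots> = (\<theta> * dt) * ?N"
        by (simp add: \<theta>_def algebra_simps)
      finally show ?thesis
        using mono(1) by blast
    qed
    have "L2_grid (E r) \<and> L2_norm dx dy (E r) \<le> (\<theta> * dt) ^ r * L2_norm dx dy (E 0)" for r
    proof (induction r)
      case 0
      then show ?case using E0 by simp
    next
      case (Suc r)
      have "(\<theta> * dt) * L2_norm dx dy (E r)
          \<le> (\<theta> * dt) * ((\<theta> * dt) ^ r * L2_norm dx dy (E 0))"
        using Suc.IH \<theta>0 dt by (intro mult_left_mono) auto
      then show ?case
        using contract[of r] Suc.IH by (auto simp: mult.assoc)
    qed
    then show "\<forall>r. L2_grid (\<lambda>l. F (Suc r) l - Fstar l)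
        \<and> L2_norm dx dy (\<lambda>l. F (Suc r) l - Fstar l)
          \<le> (\<theta> * dt) ^ Suc r * L2_norm dx dy (\<lambda>l. F 0 l - Fstar l)"
      unfolding E_def[abs_def] by blast
  qed
qed

end
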